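(* For every $f\in\mathcal{H}$ there exists a unique $G_f\in\mathcal{A}_1^1$ such that \[ \widetilde{S(f)}(z_s^{\delta}w)=z_s^{\delta}\,(G_f\diamond_s w) \] holds for every $s\in\mu_r$ and every $w\in\mathcal{A}_r$, where $S$ is the antipode of $\mathcal{H}$.
   Context: Fix an integer $r\ge 1$ and let $\mu_r$ be the set of $r$th roots of unity in $\mathbb{C}$. Let $\mathcal{A}_r=\mathbb{Q}\langle x,y_s\mid s\in\mu_r\rangle$ be the free noncommutative polynomial algebra over $\mathbb{Q}$ on the letters $x$ and $y_s$ ($s\in\mu_r$). Write $y=y_1$, $z=x+y_1$, $z_s=x+y_s$, $\delta(1)=0$ and $\delta(s)=1$ for $s\neq 1$, $z_s^{\delta}=x+\delta(s)y_s$, and $z_{k,s}=x^{k-1}y_s$ ($k\ge1$). Let $\mathcal{A}_1=\mathbb{Q}\langle x,y\rangle\subset\mathcal{A}_r$ and $\mathcal{A}_1^1=\mathbb{Q}\oplus\mathcal{A}_1y$. $R_w$ denotes right multiplication by $w$, and $R_w^{-1}$ removal of a final factor $w$. Let $\varphi$ be the algebra automorphism of $\mathcal{A}_r$ with $\varphi(x)=z$, $\varphi(y_s)=\delta(s)y_s-y_1$. Every word is uniquely $z_{k_1,s_1}\cdots z_{k_l,s_l}x^a$ ($l,a\ge0$); define linear maps $\mathcal{I}(z_{k_1,s_1}\cdots z_{k_l,s_l}x^a)=z_{k_1,s_1}z_{k_2,s_1s_2}\cdots z_{k_l,s_1\cdots s_l}x^a$ and $M_s(z_{k_1,s_1}\cdots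 z_{k_l,s_l}x^a)=z_{k_1,ss_1}z_{k_2,s_2}\cdots z_{k_l,s_l}x^a$ (with $M_s(x^a)=x^a$), and $\psi_s=\varphi\circ\mathcal{I}\circ M_s$. Diamond product: for $s\in\mu_r$, $\diamond_s:\mathcal{A}_1\times\mathcal{A}_r\to\mathcal{A}_r$ is the $\mathbb{Q}$-bilinear map defined recursively on words by $1\diamond_s w=w$, $v\diamond_s1=\psi_s\varphi(v)$, and for $v\in\mathcal{A}_1$, $w\in\mathcal{A}_r$, $1\ne t\in\mu_r$: $vx\diamond_s wx=(v\diamond_s wx)x-(vy\diamond_s w)x$; $vy\diamond_s wx=(v\diamond_s wx)y+(vy\diamond_s w)x$; $vx\diamond_s wy=(v\diamond_s wy)x+(vx\diamond_s w)y$; $vy\diamond_s wy=(v\diamond_s wy)y-(vx\diamond_s w)y$; $vx\diamond_s wy_t=(v\diamond_s wy_t)x+(v\diamond_s wz_t)y_t-(vy\diamond_s w)y_t$; $vy\diamond_s wy_t=(v\diamond_s wy_t)y-(v\diamond_s wz_t)y_t+(vy\diamond_s w)y_t$. Rooted trees: $\mathcal{H}$ is the Connes–Kreimer Hopf algebra over $\mathbb{Q}$: the commutative polynomial algebra on (non-planar) rooted trees, with basis the rooted forests and unit the empty forest $\mathbb{I}$; $\bullet$ is the one-vertex tree. $B_+$ sends a forest to the tree obtained by attaching all its roots to a new root ($B_+(\mathbb{I})=\bullet$). The coproduct $\Delta$ is the algebra map with $\Delta(\mathbb{I})=\mathbb{I}\otimes\mathbb{I}$ and $\Delta(B_+(f))=B_+(f)\otimes\mathbb{I}+(\mathrm{id}\otimes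 B_+)\Delta(f)$; the counit kills nonempty forests; the antipode $S$ is the algebra anti-automorphism with $m(S\otimes\mathrm{id})\Delta=m(\mathrm{id}\otimes S)\Delta=\mathbb{I}\cdot\varepsilon$. Write $\Delta(f)=\sum_{(f)}f'\otimes f''$. Rooted tree maps: $\widetilde{\mathbb{I}}=\mathrm{id}$, and for each forest $f\ne\mathbb{I}$ the linear map $\widetilde{f}:\mathcal{A}_r\to\mathcal{A}_r$ is determined by $\widetilde f(1)=0$ and: (I) $\widetilde{\bullet}(z_s^\delta)=z_s^\delta(z-z_s^\delta)$, $\widetilde{\bullet}(z)=0$; (II) for a forest $f\ne\mathbb{I}$, $\widetilde{B_+(f)}(z_s^\delta)=R_{z-z_s^\delta}R_{2z-z_s^\delta}R_{z-z_s^\delta}^{-1}\widetilde f(z_s^\delta)$ and $\widetilde{B_+(f)}(z)=0$; (III) if $f=gh$, $\widetilde f(v)=\widetilde g(\widetilde h(v))$ for $v\in\{z,z_s^\delta\mid s\in\mu_r\}$; (IV) $\widetilde f(wv)=\sum_{(f)}\widetilde{f'}(w)\widetilde{f''}(v)$ for $w\in\mathcal{A}_r$, $v\in\{z,z_s^\delta\mid s\in\mu_r\}$. These are well defined and $f\mapsto\widetilde f$ extends linearly to an algebra homomorphism $\mathcal{H}\to\mathrm{End}_{\mathbb{Q}}(\mathcal{A}_r)$. *)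

theory Defs
  imports Complex_Main "HOL-Library.Poly_Mapping" "HOL-Library.Multiset" "HOL-Library.Product_Plus"
begin

text \<open>Letters: X is x, Y s is y_s (the index s is a complex number; the letters of
  A_r are those with s an r-th root of unity).\<close>
datatype letter = X | Y complex

datatype word = W (letters: "letter list")

instantiation word :: monoid_add
begin
definition zero_word :: word where "zero_word = W []"
definition plus_word :: "word \<Rightarrow> word \<Rightarrow> word" where
  "plus_word u v = W (letters u @ letters v)"
instance by standard (auto simp: zero_word_def plus_word_def)
end

text \<open>Noncommutative polynomials with rational coefficients: finitely supported
  functions words -> Q; the multiplication is concatenation product.\<close>
type_synonym ncp = "word \<Rightarrow>\<^sub>0 rat"

definition sc :: "rat \<Rightarrow> ('a \<Rightarrow>\<^sub>0 rat) \<Rightarrow> ('a \<Rightarrow>\<^sub>0 rat)" where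
  "sc c p = Poly_Mapping.map (\<lambda>a. c * a) p"

definition wd :: "word \<Rightarrow> ncp" where "wd w = Poly_Mapping.single w 1"

definition lt :: "letter \<Rightarrow> ncp" where "lt a = wd (W [a])"

definition xx :: ncp where "xx = lt X"
definition yy :: "complex \<Rightarrow> ncp" where "yy s = lt (Y s)"
definition zz :: ncp where "zz = xx + yy 1"
definition delta :: "complex \<Rightarrow> rat" where "delta s = (if s = 1 then 0 else 1)"
definition zd :: "complex \<Rightarrow> ncp" where "zd s = xx + sc (delta s) (yy s)"

definition linext :: "('a \<Rightarrow> ('b \<Rightarrow>\<^sub>0 rat)) \<Rightarrow> ('a \<Rightarrow>\<^sub>0 rat) \<Rightarrow> ('b \<Rightarrow>\<^sub>0 rat)" where
  "linext g p = (\<Sum>w\<in>Poly_Mapping.keys p. sc (Poly_Mapping.lookup p w) (g w))"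

definition qlinear :: "(('a \<Rightarrow>\<^sub>0 rat) \<Rightarrow> ('b \<Rightarrow>\<^sub>0 rat)) \<Rightarrow> bool" where
  "qlinear F \<longleftrightarrow> (\<forall>p q. F (p + q) = F p + F q) \<and> (\<forall>c p. F (sc c p) = sc c (F p))"

definition inAr :: "nat \<Rightarrow> ncp \<Rightarrow> bool" where
  "inAr r p \<longleftrightarrow> (\<forall>w\<in>Poly_Mapping.keys p. \<forall>s. Y s \<in> set (letters w) \<longrightarrow> s ^ r = 1)"
definition inA1 :: "ncp \<Rightarrow> bool" where
  "inA1 p \<longleftrightarrow> (\<forall>w\<in>Poly_Mapping.keys p. set (letters w) \<subseteq> {X, Y 1})"
definition inA11 :: "ncp \<Rightarrow> bool" where
  "inA11 p \<longleftrightarrow> inA1 p \<and> (\<forall>w\<in>Poly_Mapping.keys p. letters w = [] \<or> last (letters w) = Y 1)"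

fun phi_letter :: "letter \<Rightarrow> ncp" where
  "phi_letter X = zz"
| "phi_letter (Y s) = sc (delta s) (yy s) - yy 1"

definition phi_word :: "word \<Rightarrow> ncp" where
  "phi_word w = foldr (\<lambda>a p. phi_letter a * p) (letters w) 1"

definition phi :: "ncp \<Rightarrow> ncp" where "phi = linext phi_word"

text \<open>I: z_{k1,s1} ... z_{kl,sl} x^a  |->  z_{k1,s1} z_{k2,s1 s2} ... z_{kl,s1...sl} x^a.\<close>
fun Iaux :: "complex \<Rightarrow> letter list \<Rightarrow> letter list" where
  "Iaux c [] = []"
| "Iaux c (X # as) = X # Iaux c as"
| "Iaux c (Y t # as) = Y (c * t) # Iaux (c * t) as"

definition Imap :: "ncp \<Rightarrow> ncp" where "Imap = linext (\<lambda>w. wd (W (Iaux 1 (letters w))))"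

fun Maux :: "complex \<Rightarrow> letter list \<Rightarrow> letter list" where
  "Maux s [] = []"
| "Maux s (X # as) = X # Maux s as"
| "Maux s (Y t # as) = Y (s * t) # as"

definition Mmap :: "complex \<Rightarrow> ncp \<Rightarrow> ncp" where
  "Mmap s = linext (\<lambda>w. wd (W (Maux s (letters w))))"

definition psi :: "complex \<Rightarrow> ncp \<Rightarrow> ncp" where "psi s = phi \<circ> Imap \<circ> Mmap s"

definition Rl :: "letter \<Rightarrow> ncp \<Rightarrow> ncp" where "Rl a p = p * lt a"

text \<open>dia_r s rv rw = v \<diamond>_s w for the words v = rev rv (in A_1) and w = rev rw
  (recursion on the last letters).  A letter Y _ of v is read as y = y_1
  (only words of A_1 are ever used as first argument).\<close>
function dia_r :: "complex \<Rightarrow> letter list \<Rightarrow> letter list \<Rightarrow> ncp" where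
  "dia_r s [] rw = wd (W (rev rw))"
| "dia_r s (a # rv) [] = psi s (phi (wd (W (rev (a # rv)))))"
| "dia_r s (X # rv) (X # rw) =
     Rl X (dia_r s rv (X # rw)) - Rl X (dia_r s (Y 1 # rv) rw)"
| "dia_r s (Y a # rv) (X # rw) =
     Rl (Y 1) (dia_r s rv (X # rw)) + Rl X (dia_r s (Y 1 # rv) rw)"
| "dia_r s (X # rv) (Y t # rw) =
     (if t = 1 then Rl X (dia_r s rv (Y 1 # rw)) + Rl (Y 1) (dia_r s (X # rv) rw)
      else Rl X (dia_r s rv (Y t # rw))
           + Rl (Y t) (dia_r s rv (X # rw) + dia_r s rv (Y t # rw))
           - Rl (Y t) (dia_r s (Y 1 # rv) rw))"
| "dia_r s (Y a # rv) (Y t # rw) =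
     (if t = 1 then Rl (Y 1) (dia_r s rv (Y 1 # rw)) - Rl (Y 1) (dia_r s (X # rv) rw)
      else Rl (Y 1) (dia_r s rv (Y t # rw))
           - Rl (Y t) (dia_r s rv (X # rw) + dia_r s rv (Y t # rw))
           + Rl (Y t) (dia_r s (Y 1 # rv) rw))"
  by pat_completeness auto
termination
  by (relation "measure (\<lambda>(s, a, b). length a + length b)") auto

definition diamond :: "complex \<Rightarrow> ncp \<Rightarrow> ncp \<Rightarrow> ncp" where
  "diamond s v w = (\<Sum>u\<in>Poly_Mapping.keys v. \<Sum>u'\<in>Poly_Mapping.keys w.
      sc (Poly_Mapping.lookup v u * Poly_Mapping.lookup w u') (dia_r s (rev (letters u)) (rev (letters u'))))"

text \<open>Non-planar rooted trees; a tree Node F is B_+ of the forest F.\<close>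
datatype tree = Node "tree multiset"

type_synonym forest = "tree multiset"

text \<open>H: commutative polynomial algebra on trees = finitely supported functions
  forests -> Q with product induced by union of forests (empty forest = unit).\<close>
type_synonym hck = "forest \<Rightarrow>\<^sub>0 rat"
text \<open>H \<otimes> H with basis pairs of forests.\<close>
type_synonym hck2 = "(forest \<times> forest) \<Rightarrow>\<^sub>0 rat"

definition idBplus :: "hck2 \<Rightarrow> hck2" where
  "idBplus = linext (\<lambda>(a, b). Poly_Mapping.single (a, {#Node b#}) 1)"

primrec cop_tree :: "tree \<Rightarrow> hck2" where
  "cop_tree (Node F) = Poly_Mapping.single ({#Node F#}, {#}) 1
      + idBplus (prod_mset (image_mset cop_tree F))"

definition cop :: "forest \<Rightarrow> hck2" where
  "cop F = prod_mset (image_mset cop_tree F)"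

definition DeltaH :: "hck \<Rightarrow> hck2" where "DeltaH = linext cop"

definition counit :: "hck \<Rightarrow> rat" where "counit p = Poly_Mapping.lookup p {#}"

definition antipode_ok :: "(hck \<Rightarrow> hck) \<Rightarrow> bool" where
  "antipode_ok S \<longleftrightarrow> qlinear S \<and> S 1 = 1 \<and> (\<forall>p q. S (p * q) = S q * S p) \<and> bij S \<and>
     (\<forall>p. (\<Sum>k\<in>Poly_Mapping.keys (DeltaH p). sc (Poly_Mapping.lookup (DeltaH p) k)
            (S (Poly_Mapping.single (fst k) 1) * Poly_Mapping.single (snd k) 1)) = sc (counit p) 1) \<and>
     (\<forall>p. (\<Sum>k\<in>Poly_Mapping.keys (DeltaH p). sc (Poly_Mapping.lookup (DeltaH p) k)
            (Poly_Mapping.single (fst k) 1 * S (Poly_Mapping.single (snd k) 1))) = sc (counit p) 1)"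

definition antipode :: "hck \<Rightarrow> hck" where "antipode = (THE S. antipode_ok S)"

text \<open>Conditions (I)-(IV).  They are imposed for all letters y_s (s complex),
  which determines the maps uniquely on the whole free algebra; on A_r they are
  the rooted tree maps of the paper.\<close>
definition rtm_ok :: "(forest \<Rightarrow> ncp \<Rightarrow> ncp) \<Rightarrow> bool" where
  "rtm_ok T \<longleftrightarrow>
     T {#} = id \<and>
     (\<forall>f. f \<noteq> {#} \<longrightarrow> qlinear (T f) \<and> T f 1 = 0) \<and>
     (\<forall>s. T {#Node {#}#} (zd s) = zd s * (zz - zd s)) \<and> T {#Node {#}#} zz = 0 \<and>
     (\<forall>f s. f \<noteq> {#} \<longrightarrow> (\<exists>q. T f (zd s) = q * (zz - zd s) \<and>
                T {#Node f#} (zd s) = q * (2 * zz - zd s) * (zz - zd s))) \<and>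
     (\<forall>f. f \<noteq> {#} \<longrightarrow> T {#Node f#} zz = 0) \<and>
     (\<forall>g h v. v \<in> insert zz (range zd) \<longrightarrow> T (g + h) v = T g (T h v)) \<and>
     (\<forall>f w v. v \<in> insert zz (range zd) \<longrightarrow>
        T f (w * v) = (\<Sum>k\<in>Poly_Mapping.keys (cop f). sc (Poly_Mapping.lookup (cop f) k) (T (fst k) w * T (snd k) v)))"

definition rtm :: "forest \<Rightarrow> ncp \<Rightarrow> ncp" where "rtm = (THE T. rtm_ok T)"

definition tilde :: "hck \<Rightarrow> ncp \<Rightarrow> ncp" where
  "tilde p w = (\<Sum>F\<in>Poly_Mapping.keys p. sc (Poly_Mapping.lookup p F) (rtm F w))"

end

theory Submission
  imports Defs
begin

text \<open>
  Put \<open>z = x + y\<close>, \<open>u\<^sub>t = z\<^sub>t\<^sup>\<delta>\<close>, \<open>d\<^sub>t = z - u\<^sub>t\<close>. In the free generators \<open>z, u\<^sub>t\<close> the diamond product is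
  the quasi-shuffle recursion \<open>vz \<diamond> w = (v \<diamond> w)z = v \<diamond> wz\<close>,
  \<open>vy \<diamond>\<^sub>s wu\<^sub>t = (v \<diamond>\<^sub>s wu\<^sub>t)d\<^sub>t + (vy \<diamond>\<^sub>s w)u\<^sub>t\<close>, \<open>vy \<diamond>\<^sub>s 1 = (v \<diamond>\<^sub>s 1)d\<^sub>s\<close>, so \<open>\<diamond>\<^sub>1\<close> is commutative on
  \<open>A\<^sub>1\<close> and \<open>A\<^sub>1\<close> acts on \<open>A\<^sub>r\<close> through \<open>\<diamond>\<^sub>s\<close>.

  Attach to each forest a polynomial \<open>K\<^sub>f\<close> in \<open>A\<^sub>1\<^sup>1\<close> by \<open>K\<^sub>f\<^sub>g = K\<^sub>f \<diamond>\<^sub>1 K\<^sub>g\<close> and \<open>K = L(K\<^sub>f)\<close> for the tree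
  \<open>B\<^sub>+(f)\<close>, where \<open>L(1) = y\<close> and \<open>L(ay) = a(z + y)y\<close>. The maps \<open>u\<^sub>s w \<mapsto> u\<^sub>s (K\<^sub>f \<diamond>\<^sub>s w)\<close>, extended by
  \<open>1 \<mapsto> 0\<close> and left \<open>z\<close>-linearity, satisfy (I)-(IV), hence are the rooted tree maps. By linearity
  every element \<open>h\<close> of the Hopf algebra then acts by \<open>u\<^sub>s w \<mapsto> u\<^sub>s (K\<^sub>h \<diamond>\<^sub>s w)\<close>, and \<open>G\<^sub>f\<close> is \<open>K\<^sub>h\<close> for
  \<open>h = S(f)\<close>. Taking \<open>s = 1\<close> and \<open>w = 1\<close> recovers \<open>G\<^sub>f\<close>.
\<close>

section \<open>Linear algebra on finitely supported functions\<close>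

lemma lookup_sc [simp]: "Poly_Mapping.lookup (sc c p) k = c * Poly_Mapping.lookup p k"
  by (simp add: sc_def Poly_Mapping.map.rep_eq when_def)

lemma sc_add_right: "sc c (p + q) = sc c p + sc c q"
  by (rule poly_mapping_eqI) (simp add: lookup_add algebra_simps)

lemma sc_add_left: "sc (a + b) p = sc a p + sc b p"
  by (rule poly_mapping_eqI) (simp add: lookup_add algebra_simps)

lemma sc_diff_right: "sc c (p - q) = sc c p - sc c q"
  by (rule poly_mapping_eqI) (simp add: lookup_minus algebra_simps)

lemma sc_sc [simp]: "sc a (sc b p) = sc (a * b) p"
  by (rule poly_mapping_eqI) simp

lemma sc_zero_left [simp]: "sc 0 p = 0"
  by (rule poly_mapping_eqI) simp

lemma sc_zero_right [simp]: "sc c 0 = 0"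
  by (rule poly_mapping_eqI) simp

lemma sc_one [simp]: "sc 1 p = p"
  by (rule poly_mapping_eqI) simp

lemma sc_minus_one: "sc (- 1) p = - p"
  by (rule poly_mapping_eqI) simp

lemma sc_minus_right: "sc c (- p) = - sc c p"
  by (rule poly_mapping_eqI) simp

lemma sc_sum_right: "sc c (sum g A) = (\<Sum>a\<in>A. sc c (g a))"
  by (induction A rule: infinite_finite_induct) (simp_all add: sc_add_right)

lemma sc_mult_left: "sc c (p :: 'a::monoid_add \<Rightarrow>\<^sub>0 rat) * q = sc c (p * q)"
  by (simp add: sc_def mult_map_scale_conv_mult mult.assoc)

text \<open>Words do not commute, but the unit word commutes with everything, so constants are
  central. Hence scalars can also be pulled out of the right factor of a product.\<close>

lemma single_zero_commute:
  "Poly_Mapping.single 0 c * p = p * Poly_Mapping.single (0::'a::monoid_add) (c :: rat)"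
proof (rule poly_mapping_eqI)
  fix k
  have eq: "Sum_any (\<lambda>b. (c when b = 0) when k = a + b) = (c when k = a)" for a :: 'a
  proof -
    have "Sum_any (\<lambda>b. (c when b = 0) when k = a + b) = Sum_any (\<lambda>b::'a. (c when k = a) when b = 0)"
      by (rule Sum_any.cong) (auto simp: when_def)
    then show ?thesis
      by simp
  qed
  show "Poly_Mapping.lookup (Poly_Mapping.single 0 c * p) k = Poly_Mapping.lookup (p * Poly_Mapping.single 0 c) k"
    by (simp add: lookup_mult lookup_single when_mult mult_when mult.commute eq)
qed

lemma sc_mult_right: "p * sc c (q :: 'a::monoid_add \<Rightarrow>\<^sub>0 rat) = sc c (p * q)"
  by (simp add: sc_def mult_map_scale_conv_mult single_zero_commute[of c q] mult.assoc
      flip: single_zero_commute[of c "p * q"])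
    (simp add: single_zero_commute mult.assoc)

lemmas sc_simps = sc_add_right sc_diff_right sc_mult_left sc_mult_right

lemma linext_superset:
  assumes "finite A" and "Poly_Mapping.keys p \<subseteq> A"
  shows "linext g p = (\<Sum>k\<in>A. sc (Poly_Mapping.lookup p k) (g k))"
  unfolding linext_def
  by (rule sum.mono_neutral_left) (use assms in \<open>auto simp: in_keys_iff\<close>)

lemma linext_add: "linext g (p + q) = linext g p + linext g q"
proof -
  let ?A = "Poly_Mapping.keys p \<union> Poly_Mapping.keys q"
  have "linext g (p + q) = (\<Sum>k\<in>?A. sc (Poly_Mapping.lookup (p + q) k) (g k))"
    by (rule linext_superset) (auto dest: subsetD[OF keys_add])
  moreover have "linext g p = (\<Sum>k\<in>?A. sc (Poly_Mapping.lookup p k) (g k))"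
    by (rule linext_superset) auto
  moreover have "linext g q = (\<Sum>k\<in>?A. sc (Poly_Mapping.lookup q k) (g k))"
    by (rule linext_superset) auto
  ultimately show ?thesis
    by (simp add: lookup_add sc_add_left sum.distrib)
qed

lemma linext_sc: "linext g (sc c p) = sc c (linext g p)"
proof -
  have "linext g (sc c p) = (\<Sum>k\<in>Poly_Mapping.keys p. sc (Poly_Mapping.lookup (sc c p) k) (g k))"
    by (rule linext_superset) (auto simp: in_keys_iff)
  then show ?thesis
    by (simp add: sc_sum_right linext_def)
qed

lemma linext_single [simp]: "linext g (Poly_Mapping.single k 1) = g k"
  by (simp add: linext_def)

lemma linext_one [simp]: "linext g (1 :: 'a::monoid_add \<Rightarrow>\<^sub>0 rat) = g 0"
  using linext_single[of g 0] by simp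

lemma qlinear_linext [intro]: "qlinear (linext g)"
  by (simp add: qlinear_def linext_add linext_sc)

lemma qlinear_addD: "qlinear F \<Longrightarrow> F (p + q) = F p + F q"
  and qlinear_scD: "qlinear F \<Longrightarrow> F (sc c p) = sc c (F p)"
  by (auto simp: qlinear_def)

lemma qlinear_zero: "qlinear F \<Longrightarrow> F 0 = 0"
  using qlinear_scD[of F 0 0] by simp

lemma qlinear_diff: "qlinear F \<Longrightarrow> F (p - q) = F p - F q"
  using qlinear_addD[of F p "sc (- 1) q"] qlinear_scD[of F "- 1" q] by (simp add: sc_minus_one)

lemma qlinear_sum: "qlinear F \<Longrightarrow> F (sum g A) = (\<Sum>a\<in>A. F (g a))"
  by (induction A rule: infinite_finite_induct) (simp_all add: qlinear_zero qlinear_addD)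

lemma qlinear_id [intro]: "qlinear (\<lambda>p. p)"
  by (simp add: qlinear_def)

lemma qlinear_mult_right [intro]:
  "qlinear F \<Longrightarrow> qlinear (\<lambda>p. F p * (q :: 'b::monoid_add \<Rightarrow>\<^sub>0 rat))"
  by (simp add: qlinear_def sc_simps algebra_simps)

lemma qlinear_mult_left [intro]:
  "qlinear F \<Longrightarrow> qlinear (\<lambda>p. (q :: 'b::monoid_add \<Rightarrow>\<^sub>0 rat) * F p)"
  by (simp add: qlinear_def sc_simps algebra_simps)

lemma linext_compose: "qlinear F \<Longrightarrow> F (linext g p) = linext (\<lambda>k. F (g k)) p"
  by (simp add: linext_def qlinear_sum qlinear_scD)

lemma linext_basis: "linext (\<lambda>k. Poly_Mapping.single k 1) p = p"
  by (rule poly_mapping_eqI)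
    (simp add: linext_def lookup_sum lookup_single when_def in_keys_iff if_distrib cong: if_cong)

lemma linext_cong:
  "(\<And>k. k \<in> Poly_Mapping.keys p \<Longrightarrow> g k = h k) \<Longrightarrow> linext g p = linext h p"
  by (simp add: linext_def)

lemma qlinear_expand: "qlinear F \<Longrightarrow> F p = linext (\<lambda>k. F (Poly_Mapping.single k 1)) p"
  using linext_compose[of F "\<lambda>k. Poly_Mapping.single k 1" p] by (simp add: linext_basis)

lemma qlinear_eqI:
  assumes "qlinear F" and "qlinear G"
    and "\<And>k. k \<in> Poly_Mapping.keys p \<Longrightarrow> F (Poly_Mapping.single k 1) = G (Poly_Mapping.single k 1)"
  shows "F p = G p"
  using assms qlinear_expand[of F p] qlinear_expand[of G p] by (metis (no_types, lifting) linext_cong)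

lemma qlinear_linext_fun [intro]: "(\<And>k. qlinear (\<lambda>p. g p k)) \<Longrightarrow> qlinear (\<lambda>p. linext (g p) q)"
  by (simp add: qlinear_def linext_def sum.distrib sc_add_right sc_sum_right mult.commute)

lemma linext_add_fun: "linext (\<lambda>k. g k + h k) p = linext g p + linext h p"
  by (simp add: linext_def sc_add_right sum.distrib)

lemma linext_mult:
  fixes p q :: "'a::monoid_add \<Rightarrow>\<^sub>0 rat"
  shows "linext g (p * q) = linext (\<lambda>k. linext (\<lambda>l. g (k + l)) q) p"
proof -
  have "linext g (Poly_Mapping.single k 1 * q) = linext (\<lambda>l. g (k + l)) q" for k
    by (rule qlinear_eqI[where F = "\<lambda>q. linext g (Poly_Mapping.single k 1 * q)"])
      (auto simp: mult_single qlinear_def linext_add linext_sc sc_simps distrib_left)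
  then show ?thesis
    by (subst qlinear_expand[of "\<lambda>p. linext g (p * q)"])
      (auto simp: qlinear_def linext_add linext_sc sc_simps distrib_right)
qed

text \<open>Limiting the basis case to the support of \<open>p\<close> lets a hypothesis such as
  \<open>inA1 p\<close> be passed on to the words of \<open>p\<close>.\<close>

lemma pm_induct [case_names basis add scale]:
  assumes basis: "\<And>k. k \<in> Poly_Mapping.keys p \<Longrightarrow> P (Poly_Mapping.single k (1::rat))"
    and add: "\<And>p q. P p \<Longrightarrow> P q \<Longrightarrow> P (p + q)"
    and scale: "\<And>c p. P p \<Longrightarrow> P (sc c p)"
    and "P 0"
  shows "P p"
proof -
  have "P (\<Sum>k\<in>A. sc (Poly_Mapping.lookup p k) (Poly_Mapping.single k 1))"
    if "A \<subseteq> Poly_Mapping.keys p" for A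
    using finite_subset[OF that finite_keys] that
    by (induction A rule: finite_induct) (auto intro: assms)
  from this[of "Poly_Mapping.keys p"] show ?thesis
    using linext_basis[of p] by (simp add: linext_def)
qed

section \<open>The generators z and z_s of the free algebra\<close>

text \<open>Equals \<open>yy 1 - sc (delta s) (yy s)\<close>, that is
  \<open>- phi_letter (Y s)\<close>. Condition (II) strips and appends this factor on the
  right.\<close>

definition dd :: "complex \<Rightarrow> ncp" where "dd s = zz - zd s"

lemma zd_one: "zd 1 = xx"
  by (simp add: zd_def delta_def)

lemma zd_neq_one: "s \<noteq> 1 \<Longrightarrow> zd s = xx + yy s"
  by (simp add: zd_def delta_def)

lemma dd_one: "dd 1 = yy 1"
  by (simp add: dd_def zd_one zz_def)

lemma lt_X: "lt X = zd 1"
  by (simp add: zd_one xx_def)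

lemma lt_Y: "lt (Y t) = (if t = 1 then zz - zd 1 else zd t - zd 1)"
  by (simp add: zz_def zd_one zd_neq_one yy_def)

lemma wd_Nil: "wd (W []) = 1"
  by (simp add: wd_def flip: zero_word_def)

lemma wd_append: "wd (W (u @ v)) = wd (W u) * wd (W v)"
  by (simp add: wd_def mult_single plus_word_def)

lemma wd_snoc: "wd (W (u @ [a])) = wd (W u) * lt a"
  by (simp add: wd_append lt_def)

lemma wd_Cons: "wd (W (a # u)) = lt a * wd (W u)"
  using wd_append[of "[a]" u] by (simp add: lt_def)

lemma ncp_word_induct [case_names word add scale]:
  assumes "\<And>u. W u \<in> Poly_Mapping.keys p \<Longrightarrow> P (wd (W u))"
    and "\<And>p q. P p \<Longrightarrow> P q \<Longrightarrow> P (p + q)"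
    and "\<And>c p. P p \<Longrightarrow> P (sc c p)"
    and "P 0"
  shows "P p"
proof (induction p rule: pm_induct)
  case (basis k)
  then show ?case
    using assms(1)[of "letters k"] by (simp add: wd_def)
qed (use assms in auto)

lemma closed_diff:
  assumes "\<And>p q. P p \<Longrightarrow> P q \<Longrightarrow> P (p + q)" and "\<And>c p. P p \<Longrightarrow> P (sc c p)"
    and "P p" and "P (q :: 'a \<Rightarrow>\<^sub>0 rat)"
  shows "P (p - q)"
  using assms(1)[OF assms(3) assms(2)[OF assms(4), of "- 1"]] by (simp add: sc_minus_one)

text \<open>Each letter is a generator \<open>zd 1\<close> or a difference of two generators among
  \<open>zz\<close> and \<open>zd t\<close>, so right multiplication by the generators and linear
  combinations reach every word.\<close>

lemma ncp_right_induct [case_names one add scale z zd]: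
  assumes one: "P 1"
    and add: "\<And>p q. P p \<Longrightarrow> P q \<Longrightarrow> P (p + q)"
    and scale: "\<And>c p. P p \<Longrightarrow> P (sc c p)"
    and z: "\<And>p. P p \<Longrightarrow> P (p * zz)"
    and zd: "\<And>p t. P p \<Longrightarrow> P (p * zd t)"
  shows "P p"
proof (induction p rule: ncp_word_induct)
  case (word u)
  show ?case
  proof (induction u rule: rev_induct)
    case (snoc a u)
    then show ?case
      by (cases a)
        (auto simp: wd_snoc lt_X lt_Y algebra_simps intro: closed_diff[of P] add scale z zd)
  qed (simp add: wd_Nil one)
qed (use add scale scale[OF one, of 0] in auto)

lemma ncp_left_induct [case_names one add scale z zd]:
  assumes one: "P 1"
    and add: "\<And>p q. P p \<Longrightarrow> P q \<Longrightarrow> P (p + q)"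
    and scale: "\<And>c p. P p \<Longrightarrow> P (sc c p)"
    and z: "\<And>p. P p \<Longrightarrow> P (zz * p)"
    and zd: "\<And>p t. P p \<Longrightarrow> P (zd t * p)"
  shows "P p"
proof (induction p rule: ncp_word_induct)
  case (word u)
  show ?case
  proof (induction u)
    case (Cons a u)
    then show ?case
      by (cases a)
        (auto simp: wd_Cons lt_X lt_Y algebra_simps intro: closed_diff[of P] add scale z zd)
  qed (simp add: wd_Nil one)
qed (use add scale scale[OF one, of 0] in auto)

lemma lookup_mult_lt:
  "Poly_Mapping.lookup (p * lt a) (W (u @ [b])) = (if a = b then Poly_Mapping.lookup p (W u) else 0)"
proof (induction p rule: ncp_word_induct)
  case (word v)
  then show ?case
    by (simp add: wd_snoc[symmetric]) (simp add: wd_def lookup_single when_def)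
qed (auto simp: sc_simps algebra_simps lookup_add)

lemma lookup_lt_mult:
  "Poly_Mapping.lookup (lt a * p) (W (b # u)) = (if a = b then Poly_Mapping.lookup p (W u) else 0)"
proof (induction p rule: ncp_word_induct)
  case (word v)
  then show ?case
    by (simp add: wd_Cons[symmetric]) (simp add: wd_def lookup_single when_def)
qed (auto simp: sc_simps algebra_simps lookup_add)

text \<open>For every \<open>s\<close> the letter \<open>Y 1\<close> has coefficient 1 in
  \<open>dd s\<close>, so the words ending in \<open>Y 1\<close> already recover \<open>p\<close>.
  This makes the factor \<open>q\<close> of condition (II) unique.\<close>

lemma dd_cancel:
  assumes "p * dd s = q * dd s"
  shows "p = q"
proof (rule poly_mapping_eqI)
  fix w
  have "Poly_Mapping.lookup (p * dd s) (W (letters w @ [Y 1])) = Poly_Mapping.lookup p w" for p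
    by (cases "s = 1")
      (simp_all add: dd_def zz_def zd_one zd_neq_one yy_def xx_def algebra_simps lookup_mult_lt lookup_minus)
  then show "Poly_Mapping.lookup p w = Poly_Mapping.lookup q w"
    by (metis assms)
qed

lemma xx_cancel:
  assumes "xx * p = xx * q"
  shows "p = q"
proof (rule poly_mapping_eqI)
  fix w
  have "Poly_Mapping.lookup (xx * p) (W (X # letters w)) = Poly_Mapping.lookup p w" for p
    by (simp add: xx_def lookup_lt_mult)
  then show "Poly_Mapping.lookup p w = Poly_Mapping.lookup q w"
    by (metis assms)
qed

section \<open>The subalgebra A_1 and induction over its generators z and y\<close>

lemma inA1_add: "inA1 p \<Longrightarrow> inA1 q \<Longrightarrow> inA1 (p + q)"
  by (auto simp: inA1_def dest!: subsetD[OF keys_add])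

lemma inA1_sc: "inA1 p \<Longrightarrow> inA1 (sc c p)"
  by (auto simp: inA1_def in_keys_iff)

lemma inA1_diff: "inA1 p \<Longrightarrow> inA1 q \<Longrightarrow> inA1 (p - q)"
  by (rule closed_diff[of inA1]) (auto intro: inA1_add inA1_sc)

lemma inA1_one: "inA1 1"
  by (simp add: inA1_def zero_word_def)

lemma inA1_mult: "inA1 p \<Longrightarrow> inA1 q \<Longrightarrow> inA1 (p * q)"
  by (fastforce simp: inA1_def plus_word_def dest!: subsetD[OF keys_mult])

lemma inA1_wd: "inA1 (wd (W u)) \<longleftrightarrow> set u \<subseteq> {X, Y 1}"
  by (simp add: inA1_def wd_def)

lemma inA1_xx: "inA1 xx" and inA1_yy: "inA1 (yy 1)" and inA1_zz: "inA1 zz"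
  by (auto simp: xx_def yy_def lt_def zz_def inA1_wd intro: inA1_add)

lemmas inA1_intros = inA1_add inA1_sc inA1_diff inA1_one inA1_mult inA1_xx inA1_yy inA1_zz

lemma inA1_induct [consumes 1, case_names one add scale z y]:
  assumes "inA1 p" and one: "P 1"
    and add: "\<And>p q. inA1 p \<Longrightarrow> inA1 q \<Longrightarrow> P p \<Longrightarrow> P q \<Longrightarrow> P (p + q)"
    and scale: "\<And>c p. inA1 p \<Longrightarrow> P p \<Longrightarrow> P (sc c p)"
    and z: "\<And>p. inA1 p \<Longrightarrow> P p \<Longrightarrow> P (p * zz)"
    and y: "\<And>p. inA1 p \<Longrightarrow> P p \<Longrightarrow> P (p * yy 1)"
  shows "P p"
proof -
  \<comment> \<open>Right multiplication by x is the difference of those by z and y.\<close>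
  have x: "P (p * xx) \<and> inA1 (p * xx)" if "P p" "inA1 p" for p
    using closed_diff[of "\<lambda>p. P p \<and> inA1 p" "p * zz" "p * yy 1"] that
    by (auto simp: zz_def algebra_simps inA1_intros add scale intro: z[unfolded zz_def, simplified distrib_left] y)
  have "P p \<and> inA1 p"
  proof (induction p rule: ncp_word_induct)
    case (word u)
    then have "set u \<subseteq> {X, Y 1}"
      using \<open>inA1 p\<close> by (force simp: inA1_def)
    then show ?case
      by (induction u rule: rev_induct)
        (auto simp: wd_Nil one wd_snoc x y inA1_intros simp flip: xx_def yy_def)
  qed (use add scale scale[OF _ one, of 0] inA1_one inA1_sc[OF inA1_one, of 0] in \<open>auto intro: inA1_intros\<close>)
  then show ?thesis by simp
qed

section \<open>The diamond product in the generators z and z_s\<close>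

lemma phi_word_append: "phi_word (W (u @ v)) = phi_word (W u) * phi_word (W v)"
  by (induction u) (simp_all add: phi_word_def mult.assoc)

lemma phi_mult: "phi (p * q) = phi p * phi q"
proof -
  have "linext (\<lambda>l. phi_word (k + l)) q = phi_word k * linext phi_word q" for k
    by (subst linext_compose) (auto simp: plus_word_def phi_word_append)
  then have "phi (p * q) = linext (\<lambda>k. phi_word k * phi q) p"
    by (simp add: phi_def linext_mult)
  also have "\<dots> = phi p * phi q"
    unfolding phi_def by (subst linext_compose) auto
  finally show ?thesis .
qed

lemma phi_lt: "phi (lt a) = phi_letter a"
  by (simp add: phi_def lt_def wd_def phi_word_def)

lemma inA1_phi:
  assumes "inA1 p"
  shows "inA1 (phi p)"
proof -
  have lin: "phi (p + q) = phi p + phi q" "phi (sc c p) = sc c (phi p)" for p q c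
    by (simp_all add: phi_def linext_add linext_sc)
  have gens: "phi 1 = 1" "phi zz = zz - yy 1" "phi (yy 1) = - yy 1"
    by (simp_all add: zz_def xx_def yy_def lin phi_lt delta_def)
      (simp add: phi_def phi_word_def zero_word_def)
  have minus_y: "inA1 (- yy 1)"
    using inA1_sc[OF inA1_yy, of "- 1"] by (simp add: sc_minus_one)
  show ?thesis
    using assms
    by (induction p rule: inA1_induct)
      (auto simp del: mult_minus_right simp: lin phi_mult gens minus_y intro!: inA1_intros)
qed

text \<open>On A_1 all labels are 1, so \<open>Maux s\<close> puts \<open>s\<close> on the first y
  and \<open>Iaux 1\<close> carries it to all later ones: together they replace every y by y_s.
  Hence psi_s acts on A_1 as the homomorphism with x to z and y to \<open>- dd s\<close>.\<close>

lemma Iaux_Maux_snoc: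
  assumes "set u \<subseteq> {X, Y 1}"
  shows "Iaux 1 (Maux s (u @ [X])) = Iaux 1 (Maux s u) @ [X]"
    and "Iaux 1 (Maux s (u @ [Y 1])) = Iaux 1 (Maux s u) @ [Y s]"
proof -
  have I: "Iaux s (v @ [X]) = Iaux s v @ [X]" "Iaux s (v @ [Y 1]) = Iaux s v @ [Y s]"
    if "set v \<subseteq> {X, Y 1}" for v
    using that by (induction v) auto
  show "Iaux 1 (Maux s (u @ [X])) = Iaux 1 (Maux s u) @ [X]"
    "Iaux 1 (Maux s (u @ [Y 1])) = Iaux 1 (Maux s u) @ [Y s]"
    using assms by (induction u) (auto simp: I)
qed

lemma qlinear_psi: "qlinear (psi s)"
  by (simp add: qlinear_def psi_def phi_def Imap_def Mmap_def linext_add linext_sc)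

lemma psi_wd: "psi s (wd (W u)) = phi (wd (W (Iaux 1 (Maux s u))))"
  by (simp add: psi_def Imap_def Mmap_def wd_def)

lemma psi_mult:
  assumes "inA1 p"
  shows "psi s (p * xx) = psi s p * zz" and "psi s (p * yy 1) = - (psi s p * dd s)"
proof -
  have "psi s (p * xx) = psi s p * zz \<and> psi s (p * yy 1) = - (psi s p * dd s)"
  proof (induction p rule: ncp_word_induct)
    case (word u)
    then have "set u \<subseteq> {X, Y 1}"
      using assms by (force simp: inA1_def)
    then have "psi s (wd (W (u @ [X]))) = psi s (wd (W u)) * phi_letter X"
      and "psi s (wd (W (u @ [Y 1]))) = psi s (wd (W u)) * phi_letter (Y s)"
      by (simp_all only: psi_wd Iaux_Maux_snoc) (simp_all only: wd_snoc phi_mult phi_lt)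
    moreover have "phi_letter (Y s) = - dd s"
      by (simp add: dd_def zd_def zz_def)
    ultimately show ?case
      by (simp only: wd_snoc xx_def yy_def phi_letter.simps(1) mult_minus_right simp_thms)
  qed (simp_all add: qlinear_addD[OF qlinear_psi] qlinear_scD[OF qlinear_psi] qlinear_zero[OF qlinear_psi]
        distrib_right sc_mult_left sc_minus_right)
  then show "psi s (p * xx) = psi s p * zz" and "psi s (p * yy 1) = - (psi s p * dd s)"
    by auto
qed

section \<open>Bilinear extension and recursion on the last generators\<close>

lemma diamond_linext:
  "diamond s v w = linext (\<lambda>u. linext (\<lambda>u'. dia_r s (rev (letters u)) (rev (letters u'))) w) v"
  by (simp add: diamond_def linext_def sc_sum_right)

lemma diamond_wd:
  "diamond s (wd (W u)) (wd (W u')) = dia_r s (rev u) (rev u')"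
  by (simp add: diamond_linext wd_def)

lemma qlinear_diamond_left: "qlinear (\<lambda>v. diamond s v w)"
  unfolding diamond_linext by (rule qlinear_linext)

lemma qlinear_diamond_right: "qlinear (diamond s v)"
  unfolding diamond_linext by (intro qlinear_linext_fun qlinear_linext)

lemmas diamond_add_left = qlinear_addD[OF qlinear_diamond_left]
  and diamond_sc_left = qlinear_scD[OF qlinear_diamond_left]
  and diamond_diff_left = qlinear_diff[OF qlinear_diamond_left]
  and diamond_add_right = qlinear_addD[OF qlinear_diamond_right]
  and diamond_sc_right = qlinear_scD[OF qlinear_diamond_right]
  and diamond_diff_right = qlinear_diff[OF qlinear_diamond_right]

lemmas diamond_linear = diamond_add_left diamond_sc_left diamond_diff_left
  diamond_add_right diamond_sc_right diamond_diff_right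

lemma diamond_one_left [simp]: "diamond s 1 w = w"
proof -
  have "diamond s 1 w = linext (\<lambda>u. Poly_Mapping.single u 1) w"
    by (simp add: diamond_linext zero_word_def wd_def)
  then show ?thesis
    by (simp add: linext_basis)
qed

lemma diamond_one_right: "diamond s v 1 = psi s (phi v)"
proof (induction v rule: ncp_word_induct)
  case (word u)
  show ?case
  proof (cases u rule: rev_cases)
    case Nil
    then show ?thesis
      by (simp add: wd_Nil) (simp add: wd_Nil[symmetric] phi_def psi_def Imap_def Mmap_def wd_def phi_word_def)
  next
    case (snoc v a)
    then show ?thesis
      by (simp add: wd_Nil[symmetric] diamond_wd)
  qed
qed (use qlinear_psi[of s] in \<open>auto simp: diamond_linear qlinear_def phi_def linext_add linext_sc
    qlinear_zero[OF qlinear_linext] qlinear_zero[OF qlinear_psi] qlinear_zero[OF qlinear_diamond_left]\<close>)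

text \<open>\<open>phi\<close> exchanges x and z and negates y; this sign cancels the one in
  \<open>psi_mult\<close>.\<close>

lemma diamond_one_right_mult:
  assumes "inA1 v"
  shows "diamond s (v * zz) 1 = diamond s v 1 * zz"
    and "diamond s (v * yy 1) 1 = diamond s v 1 * dd s"
proof -
  have phi: "phi xx = zz" "phi (yy 1) = - yy 1"
    by (simp_all add: xx_def yy_def phi_lt delta_def)
  then have phi_zz: "phi zz = xx"
    by (simp add: zz_def phi_def linext_add)
  show "diamond s (v * zz) 1 = diamond s v 1 * zz"
    using psi_mult(1)[OF inA1_phi[OF assms], of s] by (simp add: diamond_one_right phi_mult phi_zz)
  have "psi s (phi v * (- yy 1)) = - psi s (phi v * yy 1)"
    using qlinear_scD[OF qlinear_psi, of s "- 1" "phi v * yy 1"] by (simp add: sc_minus_one)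
  then show "diamond s (v * yy 1) 1 = diamond s v 1 * dd s"
    using psi_mult(2)[OF inA1_phi[OF assms], of s] by (simp add: diamond_one_right phi_mult phi)
qed

lemma ncp_word_induct2 [case_names word add_left scale_left add_right scale_right]:
  assumes word: "\<And>u u'. P (wd (W u)) (wd (W u'))"
    and add_left: "\<And>p q w. P p w \<Longrightarrow> P q w \<Longrightarrow> P (p + q) w"
    and scale_left: "\<And>c p w. P p w \<Longrightarrow> P (sc c p) w"
    and add_right: "\<And>v p q. P v p \<Longrightarrow> P v q \<Longrightarrow> P v (p + q)"
    and scale_right: "\<And>c v p. P v p \<Longrightarrow> P v (sc c p)"
  shows "P v w"
proof -
  have right: "P (wd (W u)) w" for u
    by (induction w rule: ncp_word_induct) (use word add_right scale_right scale_right[OF word, where c = 0] in auto)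
  show ?thesis
    by (induction v rule: ncp_word_induct) (use right add_left scale_left scale_left[OF right, where c = 0] in auto)
qed

text \<open>The defining clauses are bilinear in \<open>v\<close> and \<open>w\<close>, so they
  extend from words to polynomials.\<close>

lemma diamond_rec:
  shows "diamond s (v * xx) (w * xx) = diamond s v (w * xx) * xx - diamond s (v * yy 1) w * xx"
    and "diamond s (v * yy 1) (w * xx) = diamond s v (w * xx) * yy 1 + diamond s (v * yy 1) w * xx"
    and "diamond s (v * xx) (w * yy 1) = diamond s v (w * yy 1) * xx + diamond s (v * xx) w * yy 1"
    and "diamond s (v * yy 1) (w * yy 1) = diamond s v (w * yy 1) * yy 1 - diamond s (v * xx) w * yy 1"
    and "t \<noteq> 1 \<Longrightarrow> diamond s (v * xx) (w * yy t) = diamond s v (w * yy t) * xx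
      + diamond s v (w * xx) * yy t + diamond s v (w * yy t) * yy t - diamond s (v * yy 1) w * yy t"
    and "t \<noteq> 1 \<Longrightarrow> diamond s (v * yy 1) (w * yy t) = diamond s v (w * yy t) * yy 1
      - diamond s v (w * xx) * yy t - diamond s v (w * yy t) * yy t + diamond s (v * yy 1) w * yy t"
proof (induction v w rule: ncp_word_induct2)
  case (word u u')
  { case 1 show ?case by (simp add: xx_def yy_def wd_snoc[symmetric] diamond_wd Rl_def distrib_right) }
  { case 2 show ?case by (simp add: xx_def yy_def wd_snoc[symmetric] diamond_wd Rl_def distrib_right) }
  { case 3 show ?case by (simp add: xx_def yy_def wd_snoc[symmetric] diamond_wd Rl_def distrib_right) }
  { case 4 show ?case by (simp add: xx_def yy_def wd_snoc[symmetric] diamond_wd Rl_def distrib_right) }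
  { case 5 then show ?case by (simp add: xx_def yy_def wd_snoc[symmetric] diamond_wd Rl_def distrib_right) }
  { case 6 then show ?case by (simp add: xx_def yy_def wd_snoc[symmetric] diamond_wd Rl_def distrib_right) }
qed (simp_all add: diamond_linear sc_simps distrib_left distrib_right)

text \<open>Adding the clauses for \<open>v * xx\<close> and \<open>v * yy 1\<close> cancels all
  terms except those with \<open>v\<close> itself on the left. For the empty word,
  \<open>psi\<close> supplies the claim.\<close>

lemma diamond_zz_left:
  assumes "inA1 v"
  shows "diamond s (v * zz) w = diamond s v w * zz"
proof (induction w rule: ncp_word_induct)
  case (word u)
  show ?case
  proof (cases u rule: rev_cases)
    case Nil
    then show ?thesis
      by (simp add: wd_Nil diamond_one_right_mult assms)
  next
    case (snoc u' a)
    show ?thesis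
    proof (cases a)
      case X
      then show ?thesis
        by (simp add: snoc wd_snoc zz_def distrib_left diamond_add_left flip: xx_def)
          (simp add: diamond_rec algebra_simps)
    next
      case (Y t)
      then show ?thesis
        by (cases "t = 1"; simp add: snoc wd_snoc zz_def distrib_left diamond_add_left flip: yy_def)
          (simp_all add: diamond_rec algebra_simps)
    qed
  qed
qed (simp_all add: diamond_linear sc_simps distrib_right qlinear_zero[OF qlinear_diamond_right])

lemma diamond_zz_right:
  assumes "inA1 v"
  shows "diamond s v (w * zz) = diamond s v w * zz"
  using assms
proof (induction v rule: inA1_induct)
  case (z v)
  then show ?case by (simp add: diamond_zz_left)
next
  case (y v)
  \<comment> \<open>Both terms with x are rewritten through z; after right multiplication by y their
    z-parts are equal and cancel.\<close>
  have "diamond s (v * xx) w = diamond s v w * zz - diamond s (v * yy 1) w"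
    using diamond_zz_left[OF y(1), of s w] by (simp add: zz_def distrib_left diamond_add_left algebra_simps)
  moreover have "diamond s v (w * xx) = diamond s v w * zz - diamond s v (w * yy 1)"
    using y(2) by (simp add: zz_def distrib_left diamond_add_right algebra_simps)
  ultimately have "diamond s (v * xx) w * yy 1 = diamond s v w * zz * yy 1 - diamond s (v * yy 1) w * yy 1"
    "diamond s v (w * xx) * yy 1 = diamond s v w * zz * yy 1 - diamond s v (w * yy 1) * yy 1"
    by (simp_all add: left_diff_distrib)
  then show ?case
    by (simp add: zz_def distrib_left diamond_add_right)
      (simp add: diamond_rec zz_def distrib_left)
qed (simp_all add: diamond_linear sc_simps distrib_right)

text \<open>For \<open>t \<noteq> 1\<close> the clauses for x and y_t are added; the two right
  factors y_1 and \<open>- yy t\<close> on \<open>v \<diamond> w z_t\<close> merge into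
  \<open>dd t\<close>.\<close>

lemma diamond_yy_zd:
  "diamond s (v * yy 1) (w * zd t) = diamond s v (w * zd t) * dd t + diamond s (v * yy 1) w * zd t"
proof (cases "t = 1")
  case True
  then show ?thesis
    by (simp add: zd_one dd_one diamond_rec)
next
  case False
  then show ?thesis
    by (simp add: dd_def zd_neq_one zz_def distrib_left diamond_add_right)
      (simp add: diamond_rec algebra_simps)
qed

text \<open>Expand \<open>dd t = zz - zd t\<close>, then replace \<open>q * zd t\<close> by
  \<open>q * zz - q * dd t\<close> once more. The result has right factor \<open>dd t\<close>
  again.\<close>

lemma diamond_yy_dd:
  assumes "inA1 v"
  shows "diamond s (v * yy 1) (q * dd t)
    = (diamond s (v * yy 1) q + diamond s v (q * dd t) - diamond s v q * zz) * dd t"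
  by (simp add: dd_def right_diff_distrib diamond_diff_right diamond_zz_right diamond_yy_zd assms inA1_intros)
    (simp add: dd_def algebra_simps)

section \<open>Unit, closure, commutativity, and the action of A_1 on A_r\<close>

lemma diamond_one_one_right:
  assumes "inA1 v"
  shows "diamond 1 v 1 = v"
  using assms
  by (induction v rule: inA1_induct) (simp_all add: diamond_linear diamond_one_right_mult dd_one)

text \<open>A quasi-shuffle formula whose shape is symmetric in the two factors; closure and
  commutativity follow from it by double induction.\<close>

lemmas diamond_yy_yy_quasi_shuffle = diamond_yy_dd[of _ 1 _ 1, unfolded dd_one]

lemma inA1_diamond:
  assumes "inA1 v" and "inA1 w"
  shows "inA1 (diamond 1 v w)"
  using assms
proof (induction v arbitrary: w rule: inA1_induct)
  case (y v)
  note outer = y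
  from \<open>inA1 w\<close> show ?case
  proof (induction w rule: inA1_induct)
    case (y w)
    then show ?case
      using outer by (auto simp: diamond_yy_yy_quasi_shuffle intro!: inA1_intros)
  qed (use outer in \<open>auto simp: diamond_linear diamond_zz_right diamond_one_one_right inA1_intros intro!: inA1_intros\<close>)
qed (auto simp: diamond_linear diamond_zz_left inA1_intros)

lemma diamond_commute:
  assumes "inA1 v" and "inA1 w"
  shows "diamond 1 v w = diamond 1 w v"
  using assms
proof (induction v arbitrary: w rule: inA1_induct)
  case (y v)
  note outer = y
  from \<open>inA1 w\<close> show ?case
  proof (induction w rule: inA1_induct)
    case (y w)
    then have "diamond 1 v (w * yy 1) = diamond 1 (w * yy 1) v" "diamond 1 v w = diamond 1 w v"
      using outer by (auto intro: inA1_intros)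
    with y outer show ?case
      by (simp add: diamond_yy_yy_quasi_shuffle add.commute)
  qed (use outer in \<open>auto simp: diamond_linear diamond_zz_right diamond_zz_left diamond_one_one_right inA1_intros\<close>)
qed (auto simp: diamond_linear diamond_zz_left diamond_zz_right diamond_one_one_right)

text \<open>Triple induction over \<open>a\<close>, \<open>b\<close> and \<open>w\<close>. With
  \<open>ay \<diamond> by = Ey\<close>, the three summands of \<open>E\<close> match the three
  shorter products produced by \<open>diamond_yy_dd\<close>.\<close>

lemma diamond_assoc:
  assumes "inA1 a" and "inA1 b"
  shows "diamond s a (diamond s b w) = diamond s (diamond 1 a b) w"
  using assms
proof (induction a arbitrary: b w rule: inA1_induct)
  case (z a)
  then show ?case
    by (simp add: diamond_zz_left inA1_diamond)
next
  case (y a)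
  note outer = y
  from \<open>inA1 b\<close> show ?case
  proof (induction b arbitrary: w rule: inA1_induct)
    case (z b)
    then show ?case
      using outer by (simp add: diamond_zz_left diamond_zz_right inA1_diamond inA1_intros)
  next
    case (y b)
    note inner = y
    define E where "E = diamond 1 (a * yy 1) b + diamond 1 a (b * yy 1) - diamond 1 a b * zz"
    have E: "inA1 E" "diamond 1 (a * yy 1) (b * yy 1) = E * yy 1"
      using outer inner by (auto simp: E_def diamond_yy_yy_quasi_shuffle intro!: inA1_intros inA1_diamond)
    \<comment> \<open>The first term uses the inner induction hypothesis for \<open>b\<close>, the
      other two the outer one for \<open>a\<close>, with \<open>b * yy 1\<close> and
      \<open>b\<close>.\<close>
    have E_eq: "diamond s (a * yy 1) (diamond s b w) + diamond s a (diamond s (b * yy 1) w)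
        - diamond s a (diamond s b w) * zz = diamond s E w" for w
      using outer inner
      by (simp add: E_def diamond_add_left diamond_diff_left diamond_zz_left inA1_diamond inA1_intros)
    show ?case
    proof (induction w rule: ncp_right_induct)
      case one
      have "diamond s (a * yy 1) (diamond s (b * yy 1) 1)
        = (diamond s (a * yy 1) (diamond s b 1) + diamond s a (diamond s (b * yy 1) 1)
            - diamond s a (diamond s b 1) * zz) * dd s"
        using outer inner by (simp add: diamond_one_right_mult(2) diamond_yy_dd)
      then show ?case
        by (simp add: E E_eq diamond_one_right_mult(2))
    next
      case (z w)
      then show ?case
        using outer inner by (simp add: diamond_zz_right inA1_diamond inA1_intros)
    next
      case (zd w t)
      let ?q = "diamond s b (w * zd t)" and ?r = "diamond s (b * yy 1) w"
      have "diamond s (a * yy 1) (diamond s (b * yy 1) (w * zd t))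
        = diamond s (a * yy 1) (?q * dd t) + diamond s (a * yy 1) (?r * zd t)"
        by (simp add: diamond_yy_zd diamond_add_right)
      \<comment> \<open>Moving \<open>yy 1\<close> past \<open>zd t\<close> in the second summand
        leaves \<open>a \<diamond> (?r * zd t)\<close> times \<open>dd t\<close>; it joins
        \<open>a \<diamond> (?q * dd t)\<close>, so that the argument folds back into
        \<open>by \<diamond> (w * zd t)\<close>.\<close>
      also have "\<dots> = (diamond s (a * yy 1) ?q + diamond s a (?q * dd t + ?r * zd t)
          - diamond s a ?q * zz) * dd t + diamond s (a * yy 1) ?r * zd t"
        using outer by (simp add: diamond_yy_dd diamond_yy_zd diamond_add_right algebra_simps)
      also have "?q * dd t + ?r * zd t = diamond s (b * yy 1) (w * zd t)"
        by (simp add: diamond_yy_zd)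
      finally show ?case
        using zd by (simp add: E E_eq diamond_yy_zd[of s E])
    qed (simp_all add: diamond_linear)
  qed (simp_all add: diamond_linear diamond_one_one_right outer inA1_intros)
qed (simp_all add: diamond_linear)

section \<open>The operators induced by the diamond product\<close>

fun diamond_op_word :: "ncp \<Rightarrow> letter list \<Rightarrow> ncp" where
  "diamond_op_word v [] = 0"
| "diamond_op_word v (X # u) = zd 1 * diamond 1 v (wd (W u))"
| "diamond_op_word v (Y t # u) =
     (if t = 1 then zz * diamond_op_word v u else zd t * diamond t v (wd (W u)))
     - zd 1 * diamond 1 v (wd (W u))"

text \<open>The operator with \<open>1 \<mapsto> 0\<close>, \<open>z w \<mapsto> z (diamond_op v w)\<close> and \<open>u\<^sub>s w \<mapsto> u\<^sub>s (v \<diamond>\<^sub>s w)\<close>,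
  expressed through \<open>y = z - x\<close> and \<open>y\<^sub>t = u\<^sub>t - x\<close>.\<close>
definition diamond_op :: "ncp \<Rightarrow> ncp \<Rightarrow> ncp" where
  "diamond_op v = linext (\<lambda>w. diamond_op_word v (letters w))"

lemma qlinear_diamond_op: "qlinear (diamond_op v)"
  unfolding diamond_op_def by (rule qlinear_linext)

lemmas diamond_op_linear = qlinear_addD[OF qlinear_diamond_op] qlinear_scD[OF qlinear_diamond_op]
  qlinear_diff[OF qlinear_diamond_op]

lemma diamond_op_wd: "diamond_op v (wd (W u)) = diamond_op_word v u"
  by (simp add: diamond_op_def wd_def)

lemma diamond_op_one [simp]: "diamond_op v 1 = 0"
  by (simp add: wd_Nil[symmetric] diamond_op_wd)

lemma diamond_op_zd: "diamond_op v (zd t * w) = zd t * diamond t v w"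
proof (induction w rule: ncp_word_induct)
  case (word u)
  have one: "diamond_op v (zd 1 * wd (W u)) = zd 1 * diamond 1 v (wd (W u))"
    by (simp add: lt_X[symmetric] wd_Cons[symmetric] diamond_op_wd)
  show ?case
  proof (cases "t = 1")
    case False
    then have "zd t * wd (W u) = zd 1 * wd (W u) + wd (W (Y t # u))"
      by (simp add: wd_Cons lt_Y algebra_simps)
    then show ?thesis
      using False by (simp add: diamond_op_linear one diamond_op_wd)
  qed (simp add: one)
qed (simp_all add: distrib_left sc_mult_right diamond_op_linear diamond_linear
    qlinear_zero[OF qlinear_diamond_op] qlinear_zero[OF qlinear_diamond_right])

lemma diamond_op_zz: "diamond_op v (zz * w) = zz * diamond_op v w"
proof (induction w rule: ncp_word_induct)
  case (word u)
  have "zz * wd (W u) = zd 1 * wd (W u) + wd (W (Y 1 # u))"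
    by (simp add: wd_Cons lt_Y algebra_simps)
  then show ?case
    by (simp add: diamond_op_linear diamond_op_zd diamond_op_wd)
qed (simp_all add: distrib_left sc_mult_right diamond_op_linear qlinear_zero[OF qlinear_diamond_op])

lemma diamond_op_add_left: "diamond_op (a + b) w = diamond_op a w + diamond_op b w"
  by (induction w rule: ncp_left_induct)
    (simp_all add: diamond_op_linear diamond_op_zd diamond_op_zz diamond_linear sc_simps distrib_left)

text \<open>Associativity read on operators; this becomes condition (III).\<close>

lemma diamond_op_diamond_op:
  assumes "inA1 a" and "inA1 b"
  shows "diamond_op a (diamond_op b w) = diamond_op (diamond 1 a b) w"
  by (induction w rule: ncp_left_induct)
    (simp_all add: diamond_op_linear diamond_op_zd diamond_op_zz diamond_assoc assms
      qlinear_zero[OF qlinear_diamond_op])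

lemma diamond_op_zz_right:
  assumes "inA1 v"
  shows "diamond_op v (w * zz) = diamond_op v w * zz"
proof (induction w rule: ncp_left_induct)
  case one
  show ?case using diamond_op_zz[of v 1] by simp
qed (simp_all add: diamond_op_linear diamond_op_zd diamond_op_zz mult.assoc distrib_right sc_simps
    diamond_zz_right assms)

lemma diamond_op_one_left: "diamond_op 1 (w * zd t) = w * zd t"
proof (induction w rule: ncp_left_induct)
  case one
  show ?case using diamond_op_zd[of 1 t 1] by simp
qed (simp_all add: diamond_op_linear diamond_op_zd diamond_op_zz mult.assoc distrib_right sc_simps)

lemma diamond_op_zz_left:
  assumes "inA1 v"
  shows "diamond_op (v * zz) (w * zd t) = diamond_op v (w * zd t) * zz"
proof (induction w rule: ncp_left_induct)
  case one
  show ?case using diamond_op_zd[of _ t 1] by (simp add: diamond_one_right_mult assms mult.assoc)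
qed (simp_all add: diamond_op_linear diamond_op_zd diamond_op_zz mult.assoc distrib_right sc_simps
    diamond_zz_left assms)

lemma diamond_op_yy_zd:
  assumes "inA1 v"
  shows "diamond_op (v * yy 1) (w * zd t)
    = diamond_op v (w * zd t) * dd t + diamond_op (v * yy 1) w * zd t"
proof (induction w rule: ncp_left_induct)
  case one
  show ?case using diamond_op_zd[of _ t 1] by (simp add: diamond_one_right_mult assms mult.assoc)
qed (simp_all add: diamond_op_linear diamond_op_zd diamond_op_zz mult.assoc distrib_right distrib_left
    sc_simps diamond_yy_zd assms)

section \<open>The polynomial attached to a forest\<close>

text \<open>The map \<open>L\<close> of the overview. It is the operator of condition (II) at
  \<open>s = 1\<close>, where the stripped factor is y and \<open>2 * zz - zd 1\<close> is
  \<open>zz + yy 1\<close>.\<close>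

definition graft :: "ncp \<Rightarrow> ncp" where
  "graft = linext (\<lambda>w. if letters w = [] then yy 1 else wd (W (butlast (letters w))) * (zz + yy 1) * yy 1)"

lemma graft_one: "graft 1 = yy 1"
  by (simp add: graft_def zero_word_def)

lemma graft_mult_yy: "graft (a * yy 1) = a * (zz + yy 1) * yy 1"
proof (induction a rule: ncp_word_induct)
  case (word u)
  show ?case
    by (subst yy_def) (simp add: wd_snoc[symmetric], simp add: graft_def wd_def)
qed (simp_all add: graft_def linext_add linext_sc sc_simps distrib_right qlinear_zero[OF qlinear_linext])

text \<open>The left ideal A_1 y, which is A_1^1 without constants.\<close>

definition inA1y :: "ncp \<Rightarrow> bool" where
  "inA1y p \<longleftrightarrow> (\<exists>a. inA1 a \<and> p = a * yy 1)"

lemma inA1y_inA1: "inA1y p \<Longrightarrow> inA1 p"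
  by (auto simp: inA1y_def intro: inA1_intros)

lemma inA1y_graft: "p = 1 \<or> inA1y p \<Longrightarrow> inA1y (graft p)"
proof (auto simp: graft_one)
  show "inA1y (yy 1)"
    unfolding inA1y_def by (rule exI[of _ 1]) (simp add: inA1_one)
next
  assume "inA1y p"
  then obtain a where "inA1 a" "p = a * yy 1"
    by (auto simp: inA1y_def)
  then show "inA1y (graft p)"
    unfolding inA1y_def by (intro exI[of _ "a * (zz + yy 1)"]) (simp add: graft_mult_yy inA1_intros)
qed

lemma inA1y_diamond:
  assumes "inA1y p" and "inA1y q"
  shows "inA1y (diamond 1 p q)"
proof -
  obtain a b where "inA1 a" "p = a * yy 1" "inA1 b" "q = b * yy 1"
    using assms by (auto simp: inA1y_def)
  then show ?thesis
    unfolding inA1y_def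
    by (intro exI[of _ "diamond 1 (a * yy 1) b + diamond 1 a (b * yy 1) - diamond 1 a b * zz"])
      (simp add: diamond_yy_yy_quasi_shuffle inA1_intros inA1_diamond)
qed

text \<open>The diamond product is only known to commute on \<open>A\<^sub>1\<close>; the guard makes the fold over a
  multiset well defined everywhere.\<close>
definition guarded_diamond :: "ncp \<Rightarrow> ncp \<Rightarrow> ncp" where
  "guarded_diamond a w = (if inA1 a then diamond 1 a w else w)"

interpretation guarded_diamond: comp_fun_commute guarded_diamond
  by standard (auto simp: guarded_diamond_def fun_eq_iff diamond_assoc diamond_commute)

primrec tree_poly :: "tree \<Rightarrow> ncp" where
  "tree_poly (Node F) = graft (fold_mset guarded_diamond 1 (image_mset tree_poly F))"

definition forest_poly :: "forest \<Rightarrow> ncp" where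
  "forest_poly F = fold_mset guarded_diamond 1 (image_mset tree_poly F)"

lemma forest_poly_empty [simp]: "forest_poly {#} = 1"
  by (simp add: forest_poly_def)

lemma tree_poly_Node: "tree_poly (Node F) = graft (forest_poly F)"
  by (simp add: forest_poly_def)

text \<open>Relative to the trees of \<open>F\<close>, so that it can serve as the step of the
  structural induction on trees.\<close>

lemma forest_poly_inA1y_aux:
  "(\<And>t. t \<in># F \<Longrightarrow> inA1y (tree_poly t)) \<Longrightarrow> if F = {#} then forest_poly F = 1 else inA1y (forest_poly F)"
proof (induction F)
  case (add t F)
  then show ?case
    by (cases "F = {#}")
      (simp_all add: forest_poly_def guarded_diamond_def inA1y_inA1 diamond_one_one_right inA1y_diamond)
qed simp

lemma inA1y_tree_poly: "inA1y (tree_poly t)"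
proof (induction t)
  case (Node F)
  then have "forest_poly F = 1 \<or> inA1y (forest_poly F)"
    using forest_poly_inA1y_aux[of F] by (auto split: if_splits)
  then show ?case
    by (simp only: tree_poly_Node inA1y_graft)
qed

lemma inA1y_forest_poly: "F \<noteq> {#} \<Longrightarrow> inA1y (forest_poly F)"
  using forest_poly_inA1y_aux[of F] inA1y_tree_poly by auto

lemma inA1_forest_poly: "inA1 (forest_poly F)"
  using inA1y_inA1[OF inA1y_forest_poly] by (cases "F = {#}") (auto simp: inA1_one)

lemma forest_poly_add_mset: "forest_poly (add_mset t F) = diamond 1 (tree_poly t) (forest_poly F)"
  by (simp add: forest_poly_def guarded_diamond_def inA1y_inA1 inA1y_tree_poly)

lemma forest_poly_single: "forest_poly {#Node F#} = graft (forest_poly F)"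
  by (simp add: forest_poly_add_mset diamond_one_one_right inA1y_inA1 inA1y_tree_poly del: tree_poly.simps)
    (simp only: tree_poly_Node)

lemma forest_poly_add: "forest_poly (F + G) = diamond 1 (forest_poly F) (forest_poly G)"
  by (induction F)
    (simp_all add: forest_poly_add_mset diamond_assoc inA1y_inA1 inA1y_tree_poly inA1_forest_poly)

section \<open>Construction and uniqueness of the rooted tree maps\<close>

text \<open>The empty forest is treated apart because \<open>diamond_op 1\<close> kills 1 and the
  powers of z and so is not the identity.\<close>

definition tree_map :: "forest \<Rightarrow> ncp \<Rightarrow> ncp" where
  "tree_map f = (if f = {#} then id else diamond_op (forest_poly f))"

lemma tree_map_empty [simp]: "tree_map {#} = id"
  by (simp add: tree_map_def)

lemma qlinear_tree_map: "qlinear (tree_map f)"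
  using qlinear_diamond_op by (auto simp: tree_map_def id_def)

lemma tree_map_one: "f \<noteq> {#} \<Longrightarrow> tree_map f 1 = 0"
  by (simp add: tree_map_def)

lemma tree_map_zd: "tree_map f (zd s * w) = zd s * diamond s (forest_poly f) w"
  by (simp add: tree_map_def diamond_op_zd)

lemma tree_map_zz_right: "tree_map f (w * zz) = tree_map f w * zz"
  by (simp add: tree_map_def diamond_op_zz_right inA1_forest_poly)

lemma tree_map_add: "tree_map (f + g) w = tree_map f (tree_map g w)"
  by (simp add: tree_map_def forest_poly_add diamond_op_diamond_op diamond_one_one_right inA1_forest_poly)

text \<open>Condition (II) with an arbitrary left factor \<open>w\<close>: grafting inserts
  \<open>zz + dd t\<close> before the final \<open>dd t\<close> of the first part. The same
  \<open>e\<close> in both equations ties the grafted forest to \<open>g\<close>.\<close>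

lemma tree_map_graft:
  "\<exists>e. tree_map g (w * zd t) = e * dd t + tree_map g w * zd t \<and>
     tree_map {#Node g#} (w * zd t)
       = e * zz * dd t + tree_map g (w * zd t) * dd t + tree_map {#Node g#} w * zd t"
proof (cases "g = {#}")
  case True
  have "diamond_op (yy 1) (w * zd t) = w * zd t * dd t + diamond_op (yy 1) w * zd t"
    using diamond_op_yy_zd[OF inA1_one, of w t] by (simp add: diamond_op_one_left)
  then show ?thesis
    \<comment> \<open>\<open>tree_map {#}\<close> is the identity, which leaves no part ending in
      \<open>dd t\<close>.\<close>
    using True by (intro exI[of _ 0]) (simp add: tree_map_def forest_poly_single graft_one)
next
  case False
  then obtain a where a: "inA1 a" "forest_poly g = a * yy 1"
    using inA1y_forest_poly by (auto simp: inA1y_def)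
  have node: "forest_poly {#Node g#} = (a * zz + a * yy 1) * yy 1"
    by (simp add: forest_poly_single a graft_mult_yy distrib_left)
  have "inA1 (a * zz + a * yy 1)"
    by (simp add: a inA1_intros)
  from diamond_op_yy_zd[OF this, of w t] show ?thesis
    using False a diamond_op_yy_zd[OF a(1), of w t]
    by (intro exI[of _ "diamond_op a (w * zd t)"])
      (simp add: tree_map_def node diamond_op_add_left diamond_op_zz_left distrib_right)
qed

section \<open>Compatibility with the coproduct, condition (IV)\<close>

lemma cop_add: "cop (f + g) = cop f * cop g"
  by (simp add: cop_def)

lemma cop_single: "cop {#Node g#} = Poly_Mapping.single ({#Node g#}, {#}) 1 + idBplus (cop g)"
  by (simp add: cop_def)

lemma cop_empty: "cop {#} = 1"
  by (simp add: cop_def)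

lemma linext_idBplus: "linext h (idBplus p) = linext (\<lambda>k. h (fst k, {#Node (snd k)#})) p"
proof -
  have "linext h (idBplus p)
    = linext (\<lambda>k. linext h ((\<lambda>(a, b). Poly_Mapping.single (a, {#Node b#}) 1) k)) p"
    unfolding idBplus_def by (rule linext_compose[OF qlinear_linext])
  then show ?thesis
    by (simp add: case_prod_unfold)
qed

text \<open>Condition (IV) is proved for arbitrary right factors \<open>v\<close>, which makes it stable under products of
  forests without appealing to coassociativity; the auxiliary \<open>e\<close> of the previous recursion is
  compatible with the coproduct because \<open>d\<^sub>t\<close> can be cancelled.\<close>
lemma tree_map_mult_tree:
  assumes mult: "\<And>w v. tree_map g (w * v) = linext (\<lambda>k. tree_map (fst k) w * tree_map (snd k) v) (cop g)"
  shows "tree_map {#Node g#} (w * v)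
    = linext (\<lambda>k. tree_map (fst k) w * tree_map (snd k) v) (cop {#Node g#})"
proof -
  define N where "N f = {#Node f#}" for f :: forest
  \<comment> \<open>The witness is chosen as a function of the forest, so that it can be summed over
    the coproduct.\<close>
  obtain e where e: "tree_map f (w * zd t) = e f w t * dd t + tree_map f w * zd t"
    and Ne: "tree_map (N f) (w * zd t)
      = e f w t * zz * dd t + tree_map f (w * zd t) * dd t + tree_map (N f) w * zd t" for f w t
    using tree_map_graft unfolding N_def by metis
  \<comment> \<open>The Sweedler sum over \<open>cop g\<close> with its right tensor factor left
    open; it is linear in \<open>F\<close> and commutes with right multiplication.\<close>
  define L where "L F = linext (\<lambda>k. tree_map (fst k) w * F (snd k)) (cop g)" for F :: "forest \<Rightarrow> ncp"
  have L_add: "L (\<lambda>f. F f + G f) = L F + L G" for F G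
    by (simp add: L_def distrib_left linext_add_fun)
  have L_right: "L (\<lambda>f. F f * c) = L F * c" for F c
    by (simp add: L_def linext_compose[OF qlinear_mult_right[OF qlinear_id, of c]] mult.assoc)
  have L_sc: "L (\<lambda>f. sc c (F f)) = sc c (L F)" for F c
    by (simp add: L_def sc_mult_right linext_def sc_sum_right mult.commute)
  have L_mult: "tree_map g (w * v) = L (\<lambda>f. tree_map f v)" for v
    by (simp add: L_def mult)
  \<comment> \<open>The two terms come from the summands \<open>B_+(g) \<otimes> 1\<close> and
    \<open>(id \<otimes> B_+)\<close> applied to \<open>cop g\<close> in the coproduct of the
    grafted tree.\<close>
  have "tree_map (N g) (w * v) = tree_map (N g) w * v + L (\<lambda>f. tree_map (N f) v)"
  proof (induction v rule: ncp_right_induct)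
    case one
    then show ?case
      by (simp add: L_def N_def tree_map_one linext_def)
  next
    case (zd v t)
    have "e g (w * v) t * dd t = L (\<lambda>f. e f v t) * dd t"
    proof -
      have "e g (w * v) t * dd t + tree_map g (w * v) * zd t = L (\<lambda>f. e f v t * dd t + tree_map f v * zd t)"
        using L_mult[of "v * zd t"] by (simp add: e mult.assoc[symmetric])
      then show ?thesis
        by (simp add: L_add L_right L_mult)
    qed
    then have "e g (w * v) t = L (\<lambda>f. e f v t)"
      by (rule dd_cancel)
    then show ?case
      using zd L_mult[of "v * zd t"] by (simp add: Ne L_add L_right distrib_right mult.assoc[symmetric])
  qed (simp_all add: qlinear_addD[OF qlinear_tree_map] qlinear_scD[OF qlinear_tree_map] L_add L_sc L_right
      tree_map_zz_right sc_simps distrib_left distrib_right mult.assoc[symmetric])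
  then show ?thesis
    by (simp add: cop_single linext_add linext_idBplus L_def N_def)
qed

text \<open>Composing the two expansions multiplies the coproducts; commutativity of H restores the
  order of the factors.\<close>

lemma tree_map_mult_add:
  assumes f: "\<And>w v. tree_map f (w * v) = linext (\<lambda>k. tree_map (fst k) w * tree_map (snd k) v) (cop f)"
    and g: "\<And>w v. tree_map g (w * v) = linext (\<lambda>k. tree_map (fst k) w * tree_map (snd k) v) (cop g)"
  shows "tree_map (f + g) (w * v)
    = linext (\<lambda>k. tree_map (fst k) w * tree_map (snd k) v) (cop (f + g))"
proof -
  have "tree_map (f + g) (w * v) = linext (\<lambda>l. tree_map f (tree_map (fst l) w * tree_map (snd l) v)) (cop g)"
    by (simp add: tree_map_add g linext_compose[OF qlinear_tree_map])
  also have "\<dots> = linext (\<lambda>l. linext (\<lambda>k. tree_map (fst (l + k)) w * tree_map (snd (l + k)) v) (cop f)) (cop g)"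
    by (simp add: f tree_map_add[symmetric] add.commute)
  also have "\<dots> = linext (\<lambda>k. tree_map (fst k) w * tree_map (snd k) v) (cop g * cop f)"
    by (rule linext_mult[symmetric])
  finally show ?thesis
    by (simp add: cop_add mult.commute)
qed

lemma tree_map_mult_forest:
  assumes "\<And>t w v. t \<in># f \<Longrightarrow> tree_map {#t#} (w * v)
      = linext (\<lambda>k. tree_map (fst k) w * tree_map (snd k) v) (cop {#t#})"
  shows "tree_map f (w * v) = linext (\<lambda>k. tree_map (fst k) w * tree_map (snd k) v) (cop f)"
  using assms
proof (induction f arbitrary: w v)
  case empty
  show ?case by (simp add: cop_empty)
next
  case (add t f)
  then show ?case
    using tree_map_mult_add[of "{#t#}" f w v] by simp
qed

lemma tree_map_mult_singleton:
  "tree_map {#t#} (w * v) = linext (\<lambda>k. tree_map (fst k) w * tree_map (snd k) v) (cop {#t#})"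
proof (induction t arbitrary: w v)
  case (Node F)
  show ?case
    by (rule tree_map_mult_tree, rule tree_map_mult_forest, rule Node.IH)
qed

lemma tree_map_mult:
  "tree_map f (w * v) = linext (\<lambda>k. tree_map (fst k) w * tree_map (snd k) v) (cop f)"
  by (rule tree_map_mult_forest) (rule tree_map_mult_singleton)

lemma rtm_ok_tree_map: "rtm_ok tree_map"
proof -
  have zz: "tree_map f zz = 0" if "f \<noteq> {#}" for f
    using tree_map_zz_right[of f 1] by (simp add: tree_map_one that)
  have dot: "tree_map {#Node {#}#} (zd s) = zd s * (zz - zd s)" for s
    using tree_map_zd[of "{#Node {#}#}" s 1] diamond_one_right_mult(2)[OF inA1_one, of s]
    by (simp add: forest_poly_single graft_one dd_def)
  have graft: "\<exists>q. tree_map f (zd s) = q * (zz - zd s) \<and>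
      tree_map {#Node f#} (zd s) = q * (2 * zz - zd s) * (zz - zd s)" if "f \<noteq> {#}" for f s
  proof -
    obtain e where "tree_map f (1 * zd s) = e * dd s + tree_map f 1 * zd s"
      "tree_map {#Node f#} (1 * zd s)
        = e * zz * dd s + tree_map f (1 * zd s) * dd s + tree_map {#Node f#} 1 * zd s"
      using tree_map_graft by blast
    \<comment> \<open>At \<open>w = 1\<close> the terms ending in \<open>zd s\<close> vanish, so
      this identity makes \<open>q = e\<close> a witness.\<close>
    moreover have "2 * zz - zd s = zz + dd s"
      by (simp add: dd_def mult_2)
    ultimately show ?thesis
      using that by (intro exI[of _ e]) (simp add: tree_map_one distrib_left distrib_right flip: dd_def)
  qed
  show ?thesis
    unfolding rtm_ok_def
    by (intro conjI allI impI)
      (simp_all add: zz dot graft qlinear_tree_map tree_map_one tree_map_add tree_map_mult[unfolded linext_def])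
qed

section \<open>The grading by vertices and uniqueness of the rooted tree maps\<close>

primrec nodes :: "tree \<Rightarrow> nat" where
  "nodes (Node F) = Suc (sum_mset (image_mset nodes F))"

definition fnodes :: "forest \<Rightarrow> nat" where "fnodes F = sum_mset (image_mset nodes F)"

lemma fnodes_cop_aux:
  assumes "\<And>t k. t \<in># F \<Longrightarrow> k \<in> Poly_Mapping.keys (cop_tree t) \<Longrightarrow> fnodes (fst k) + fnodes (snd k) = nodes t"
    and "k \<in> Poly_Mapping.keys (cop F)"
  shows "fnodes (fst k) + fnodes (snd k) = fnodes F"
  using assms
proof (induction F arbitrary: k)
  case empty
  then show ?case by (simp add: cop_empty fnodes_def)
next
  case (add t F)
  then obtain k1 k2 where k: "k = k1 + k2" "k1 \<in> Poly_Mapping.keys (cop_tree t)" "k2 \<in> Poly_Mapping.keys (cop F)"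
    using keys_mult[of "cop_tree t" "cop F"] by (auto simp: cop_def)
  have "fnodes (fst k1) + fnodes (snd k1) = nodes t"
    using add.prems(1)[of t k1] k by simp
  moreover have "fnodes (fst k2) + fnodes (snd k2) = fnodes F"
    using add.IH[of k2] add.prems(1) k by simp
  ultimately show ?case
    by (simp add: k fnodes_def)
qed

lemma fnodes_cop_tree: "k \<in> Poly_Mapping.keys (cop_tree t) \<Longrightarrow> fnodes (fst k) + fnodes (snd k) = nodes t"
proof (induction t arbitrary: k)
  case (Node F)
  have "k \<in> Poly_Mapping.keys (Poly_Mapping.single ({#Node F#}, {#} :: forest) (1::rat) + idBplus (cop F))"
    using Node.prems by (simp add: cop_def)
  then have "k = ({#Node F#}, {#}) \<or> k \<in> Poly_Mapping.keys (idBplus (cop F))"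
    using keys_add by fastforce
  then show ?case
  proof
    assume "k = ({#Node F#}, {#})"
    then show ?thesis by (simp add: fnodes_def)
  next
    assume k: "k \<in> Poly_Mapping.keys (idBplus (cop F))"
    have "\<exists>l\<in>Poly_Mapping.keys (cop F). k = (fst l, {#Node (snd l)#})"
    proof (rule ccontr)
      assume "\<not> ?thesis"
      then have "Poly_Mapping.lookup (idBplus (cop F)) k = 0"
        by (auto simp: idBplus_def linext_def lookup_sum lookup_single when_def case_prod_unfold intro!: sum.neutral)
      with k show False by (simp add: in_keys_iff)
    qed
    then obtain l where l: "l \<in> Poly_Mapping.keys (cop F)" "k = (fst l, {#Node (snd l)#})"
      by blast
    have "fnodes (fst l) + fnodes (snd l) = fnodes F"
      using fnodes_cop_aux[OF _ l(1)] Node.IH by blast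
    then show ?thesis
      by (simp add: l fnodes_def)
  qed
qed

lemma fnodes_cop: "k \<in> Poly_Mapping.keys (cop F) \<Longrightarrow> fnodes (fst k) + fnodes (snd k) = fnodes F"
  using fnodes_cop_aux fnodes_cop_tree by blast

lemma fnodes_eq_0: "fnodes F = 0 \<longleftrightarrow> F = {#}"
proof
  assume "fnodes F = 0"
  then show "F = {#}"
  proof (cases F)
    case (add t G)
    then show ?thesis using \<open>fnodes F = 0\<close> by (cases t) (simp add: fnodes_def)
  qed simp
qed (simp add: fnodes_def)

lemma
  assumes "rtm_ok T"
  shows rtm_ok_empty: "T {#} = id"
    and rtm_ok_qlinear: "f \<noteq> {#} \<Longrightarrow> qlinear (T f)"
    and rtm_ok_one: "f \<noteq> {#} \<Longrightarrow> T f 1 = 0"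
    and rtm_ok_dot: "T {#Node {#}#} (zd s) = zd s * (zz - zd s)"
    and rtm_ok_zz: "T {#Node f#} zz = 0"
    and rtm_ok_graft: "f \<noteq> {#} \<Longrightarrow> \<exists>q. T f (zd s) = q * (zz - zd s) \<and>
      T {#Node f#} (zd s) = q * (2 * zz - zd s) * (zz - zd s)"
    and rtm_ok_add: "v \<in> insert zz (range zd) \<Longrightarrow> T (g + h) v = T g (T h v)"
    and rtm_ok_mult: "v \<in> insert zz (range zd) \<Longrightarrow>
      T f (w * v) = linext (\<lambda>k. T (fst k) w * T (snd k) v) (cop f)"
proof -
  note ok = assms[unfolded rtm_ok_def]
  show "T {#} = id"
    using ok by (elim conjE)
  show "qlinear (T f)" "T f 1 = 0" if "f \<noteq> {#}"
    using ok that by (elim conjE; simp)+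
  show "T {#Node {#}#} (zd s) = zd s * (zz - zd s)"
    using ok by (elim conjE) (erule spec)
  show "T {#Node f#} zz = 0"
    using ok by (elim conjE; cases "f = {#}"; simp)
  show "\<exists>q. T f (zd s) = q * (zz - zd s) \<and> T {#Node f#} (zd s) = q * (2 * zz - zd s) * (zz - zd s)"
    if "f \<noteq> {#}"
    using ok that by (elim conjE) (drule spec, drule spec, erule mp)
  show "T (g + h) v = T g (T h v)" if "v \<in> insert zz (range zd)"
    using ok that by (elim conjE) (drule spec, drule spec, drule spec, erule mp)
  show "T f (w * v) = linext (\<lambda>k. T (fst k) w * T (snd k) v) (cop f)" if "v \<in> insert zz (range zd)"
    unfolding linext_def using ok that by (elim conjE) (drule spec, drule spec, drule spec, erule mp)
qed

text \<open>Induction on the number of vertices. Agreement on the generators comes from (I)-(III);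
  (IV) then spreads it over all products, since the coproduct preserves the number of
  vertices.\<close>

lemma rtm_ok_unique:
  assumes T: "rtm_ok T" and U: "rtm_ok U"
  shows "T f = U f"
proof (induction "fnodes f" arbitrary: f rule: less_induct)
  case less
  have gen_less: "T g v = U g v" if "fnodes g < fnodes f" for g v
    using less[OF that] by simp
  \<comment> \<open>A single tree is handled by (I) or (II), which refer to its smaller forest of
    branches; several trees split by (III) into forests with fewer vertices.\<close>
  have gen: "T g v = U g v" if v: "v \<in> insert zz (range zd)" and g: "fnodes g = fnodes f" for g v
  proof -
    consider "g = {#}" | h where "g = {#Node h#}" | t h where "g = {#t#} + h" "h \<noteq> {#}"
    proof (cases g)
      case (add t h)
      then show ?thesis
        using that by (cases t; cases "h = {#}") auto
    qed (use that in auto)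
    then show ?thesis
    proof cases
      case 1
      then show ?thesis by (simp add: rtm_ok_empty T U)
    next
      case (2 h)
      have hf: "fnodes h < fnodes f"
        using g by (simp add: 2 fnodes_def[of "{#Node h#}"] flip: fnodes_def[of h])
      consider (zz) "v = zz" | (zd) s where "v = zd s"
        using v by blast
      then show ?thesis
      proof cases
        case zz
        then show ?thesis
          by (simp add: 2 rtm_ok_zz T U)
      next
        case (zd s)
        show ?thesis
        proof (cases "h = {#}")
          case True
          then show ?thesis by (simp add: 2 zd rtm_ok_dot T U)
        next
          case False
          obtain q where q: "T h (zd s) = q * (zz - zd s)" "T {#Node h#} (zd s) = q * (2 * zz - zd s) * (zz - zd s)"
            using rtm_ok_graft[OF T False] by blast
          obtain q' where q': "U h (zd s) = q' * (zz - zd s)" "U {#Node h#} (zd s) = q' * (2 * zz - zd s) * (zz - zd s)"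
            using rtm_ok_graft[OF U False] by blast
          have "q = q'"
            using q(1) q'(1) gen_less[OF hf, of "zd s"] dd_cancel[of q s q'] by (simp add: dd_def)
          then show ?thesis
            using q(2) q'(2) 2 zd by simp
        qed
      qed
    next
      case (3 t h)
      have "fnodes g = fnodes {#t#} + fnodes h"
        by (simp add: 3 fnodes_def)
      moreover have "fnodes {#t#} > 0" "fnodes h > 0"
        using fnodes_eq_0[of "{#t#}"] fnodes_eq_0[of h] 3 by auto
      ultimately have "fnodes {#t#} < fnodes f" "fnodes h < fnodes f"
        using g by auto
      moreover have "T g v = T {#t#} (T h v)" "U g v = U {#t#} (U h v)"
        unfolding 3(1) by (rule rtm_ok_add[OF T v] rtm_ok_add[OF U v])+
      ultimately show ?thesis
        by (simp add: gen_less)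
    qed
  qed
  have qlinear: "qlinear (T g)" "qlinear (U g)" for g
    using rtm_ok_qlinear[OF T, of g] rtm_ok_qlinear[OF U, of g] rtm_ok_empty[OF T] rtm_ok_empty[OF U]
    by (cases "g = {#}"; auto simp: id_def)+
  have mult: "T g (w * v) = U g (w * v)"
    if IH: "\<And>g. fnodes g \<le> fnodes f \<Longrightarrow> T g w = U g w" and v: "v \<in> insert zz (range zd)"
      and g: "fnodes g \<le> fnodes f" for g w v
  proof -
    have "T (fst k) w * T (snd k) v = U (fst k) w * U (snd k) v" if "k \<in> Poly_Mapping.keys (cop g)" for k
    proof -
      have "fnodes (fst k) \<le> fnodes f" "fnodes (snd k) \<le> fnodes f"
        using fnodes_cop[OF that] g by auto
      then show ?thesis
        using IH[of "fst k"] gen[OF v, of "snd k"] gen_less[of "snd k" v] by (cases "fnodes (snd k) = fnodes f") auto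
    qed
    then show ?thesis
      unfolding rtm_ok_mult[OF T v] rtm_ok_mult[OF U v] by (rule linext_cong)
  qed
  \<comment> \<open>All forests up to this size are treated at once, because (IV) for one of them
    evaluates other forests on the left factor.\<close>
  have "\<forall>g. fnodes g \<le> fnodes f \<longrightarrow> T g w = U g w" for w
  proof (induction w rule: ncp_right_induct)
    case one
    have "T g 1 = U g 1" for g
      by (cases "g = {#}") (simp_all add: rtm_ok_empty rtm_ok_one T U)
    then show ?case by simp
  next
    case (add p q)
    then show ?case by (simp add: qlinear_addD[OF qlinear(1)] qlinear_addD[OF qlinear(2)])
  next
    case (scale c p)
    then show ?case by (simp add: qlinear_scD[OF qlinear(1)] qlinear_scD[OF qlinear(2)])
  qed (auto intro!: mult)
  then show ?case by auto
qed

lemma rtm_eq_tree_map: "rtm = tree_map"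
  unfolding rtm_def
  by (rule the_equality) (auto intro: rtm_ok_tree_map rtm_ok_unique)

section \<open>From forests to all elements of H, and the theorem\<close>

lemma tilde_zd: "tilde h (zd s * w) = zd s * diamond s (linext forest_poly h) w"
proof -
  have "zd s * diamond s (linext forest_poly h) w = linext (\<lambda>f. zd s * diamond s (forest_poly f) w) h"
    by (rule linext_compose[OF qlinear_mult_left[OF qlinear_diamond_left]])
  then show ?thesis
    by (simp add: tilde_def rtm_eq_tree_map tree_map_zd linext_def)
qed

lemma inA11_linext_forest_poly: "inA11 (linext forest_poly h)"
proof -
  have sc: "inA11 (sc c p)" if "inA11 p" for c p
    using that by (auto simp: inA11_def inA1_sc in_keys_iff)
  have add: "inA11 (p + q)" if "inA11 p" "inA11 q" for p q
    using that by (auto simp: inA11_def inA1_add dest!: subsetD[OF keys_add])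
  have one: "inA11 1"
    by (simp add: inA11_def inA1_one zero_word_def)
  have "inA11 (forest_poly f)" for f
  proof (cases "f = {#}")
    case False
    then obtain a where "inA1 a" "forest_poly f = a * yy 1"
      using inA1y_forest_poly by (auto simp: inA1y_def)
    then show ?thesis
      using keys_mult[of a "yy 1"]
      using inA1_forest_poly[of f] by (auto simp: inA11_def yy_def lt_def wd_def plus_word_def)
  qed (simp add: one)
  then show ?thesis
    by (induction h rule: pm_induct)
      (use sc[OF one, of 0] sc add in \<open>auto simp: linext_add linext_sc qlinear_zero[OF qlinear_linext]\<close>)
qed

theorem mainTheorem3:
  fixes r :: nat and f :: hck
  assumes "r \<ge> 1"
  shows "\<exists>!G. inA11 G \<and>
           (\<forall>s w. s ^ r = 1 \<longrightarrow> inAr r w \<longrightarrow>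
              tilde (antipode f) (zd s * w) = zd s * diamond s G w)"
proof (rule ex1I[of _ "linext forest_poly (antipode f)"], goal_cases)
  case 1
  show ?case
    by (simp add: inA11_linext_forest_poly tilde_zd)
next
  case (2 G)
  have "inAr r 1"
    by (simp add: inAr_def zero_word_def)
  then have "tilde (antipode f) (zd 1 * 1) = zd 1 * diamond 1 G 1"
    using 2 by (metis power_one)
  then have "zd 1 * diamond 1 (linext forest_poly (antipode f)) 1 = zd 1 * diamond 1 G 1"
    by (simp only: tilde_zd)
  then have "diamond 1 (linext forest_poly (antipode f)) 1 = diamond 1 G 1"
    unfolding zd_one by (rule xx_cancel)
  then show ?case
    \<comment> \<open>Both polynomials lie in A_1, where 1 is a right unit for the product with
      \<open>s = 1\<close>.\<close>
    using 2 inA11_linext_forest_poly[of "antipode f"] by (simp add: diamond_one_one_right inA11_def)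
qed

end
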